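(* Let $\|\mathbf u\|_\infty=\max_{i,j}\max\{|u_{ij}|,|v_{ij}|\}$, and let $\bar L$ be the matrix of the two-dimensional fourth order scheme with backward Euler time discretization. Each of the following conditions is sufficient for the scheme to be inverse positive, i.e. for $\bar L$ to be invertible with $\bar L^{-1}\ge0$ entrywise: (1) the mesh size $h$ satisfies $h\frac{\|\mathbf u\|_\infty}{2\mu}=a<\frac{\sqrt{201}-11}{16}$ and the time step satisfies $\Delta t\frac{\mu}{h^2}\ge\frac{2a+1}{-8a^2-11a+\frac52}$; (2) the time step satisfies $\Delta t\frac{\mu}{h^2}=\frac1c>\frac25$ and the mesh size satisfies $h\frac{\|\mathbf u\|_\infty}{\mu}\le\frac{\sqrt{(c+\frac32)^2+48}-(c+\frac{11}{2})}{8}$. In particular, each of the following is also sufficient for inverse positivity: (3) $h\frac{\|\mathbf u\|_\infty}{\mu}\le\frac13$ and $\Delta t\frac{\mu}{h^2}\ge3$; (4) $\Delta t\frac{\mu}{h^2}\ge1$ and $h\frac{\|\mathbf u\|_\infty}{\mu}\le\frac{\sqrt{217}-13}{8}$.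
   Context: Grid: $\Omega=(0,1)\times(0,1)$, $x_i=ih$, $y_j=jh$ for $0\le i,j\le n+1$, with $n$ odd and $h=\frac1{n+1}$ (the uniform case $\Delta x=\Delta y=h$). A grid point is a boundary point if $i\in\{0,n+1\}$ or $j\in\{0,n+1\}$, and interior otherwise. A grid function is an array $\bar\phi=(\phi_{ij})$, with $\phi_{ij}$ the value at $(x_i,y_j)$, over all (interior and boundary) grid points. Fourth order one-dimensional stencils: for odd $k$, $(\delta_1\psi)_k=\frac{\psi_{k+1}-\psi_{k-1}}{2h}$, $(\delta_2\psi)_k=\frac{\psi_{k-1}-2\psi_k+\psi_{k+1}}{h^2}$; for even interior $k$, $(\delta_1\psi)_k=\frac{\psi_{k-2}-4\psi_{k-1}+4\psi_{k+1}-\psi_{k+2}}{4h}$, $(\delta_2\psi)_k=-\frac{\psi_{k-2}-8\psi_{k-1}+14\psi_k-8\psi_{k+1}+\psi_{k+2}}{4h^2}$. Let $\delta_{1,x},\delta_{2,x}$ (resp. $\delta_{1,y},\delta_{2,y}$) denote these stencils applied in the index $i$ (resp. $j$). Let $\mu>0$ and $\Delta t>0$ be constants, and let $u_{ij},v_{ij}\in\mathbb R$ be the values at interior grid points (at the new time level) of a given incompressible velocity field $(u,v)$; only these values enter the scheme. The scheme operator $\bar{\mathcal L}$ (for $\phi_t+u\phi_x+v\phi_y=\mu\Delta\phi$ with Dirichlet boundary conditions) is the linear map on grid functions given by $$\bar{\mathcal L}(\bar\phi)_{ij}=\phi_{ij}+\Delta t\left[u_{ij}(\delta_{1,x}\bar\phi)_{ij}+v_{ij}(\delta_{1,y}\bar\phi)_{ij}-\mu(\delta_{2,x}\bar\phi)_{ij}-\mu(\delta_{2,y}\bar\phi)_{ij}\right]$$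 at interior points, and $\bar{\mathcal L}(\bar\phi)_{ij}=\phi_{ij}$ at boundary points. $\bar L$ is its matrix with respect to any fixed ordering of all grid points. *)

theory Defs
  imports Complex_Main "Jordan_Normal_Form.Matrix"
begin

text \<open>
  A grid function is a function \<open>nat \<Rightarrow> nat \<Rightarrow> real\<close>; only its values on \<open>grid_points n\<close>
  are meaningful. Likewise only the interior values of the velocity components \<open>u\<close>, \<open>v\<close>
  are ever used. Every finite array of interior values is sampled from some incompressible
  field, so incompressibility imposes no constraint on these arrays.
\<close>

definition mesh_size :: "nat \<Rightarrow> real" where
  "mesh_size n = 1 / (real n + 1)"

definition grid_points :: "nat \<Rightarrow> (nat \<times> nat) set" where
  "grid_points n = {0..n+1} \<times> {0..n+1}"

definition boundary_points :: "nat \<Rightarrow> (nat \<times> nat) set" where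
  "boundary_points n = {(i, j) \<in> grid_points n. i \<in> {0, n+1} \<or> j \<in> {0, n+1}}"

definition interior_points :: "nat \<Rightarrow> (nat \<times> nat) set" where
  "interior_points n = grid_points n - boundary_points n"

text \<open>
  The stencils are only applied at interior indices \<open>k\<close>, i.e. \<open>k \<ge> 1\<close> for odd \<open>k\<close> and
  \<open>k \<ge> 2\<close> for even \<open>k\<close>, so the subtractions of natural numbers are never truncated there.
\<close>

definition delta1 :: "real \<Rightarrow> (nat \<Rightarrow> real) \<Rightarrow> nat \<Rightarrow> real" where
  "delta1 h \<psi> k =
    (if odd k then (\<psi> (k+1) - \<psi> (k-1)) / (2 * h)
     else (\<psi> (k-2) - 4 * \<psi> (k-1) + 4 * \<psi> (k+1) - \<psi> (k+2)) / (4 * h))"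

definition delta2 :: "real \<Rightarrow> (nat \<Rightarrow> real) \<Rightarrow> nat \<Rightarrow> real" where
  "delta2 h \<psi> k =
    (if odd k then (\<psi> (k-1) - 2 * \<psi> k + \<psi> (k+1)) / h\<^sup>2
     else - (\<psi> (k-2) - 8 * \<psi> (k-1) + 14 * \<psi> k - 8 * \<psi> (k+1) + \<psi> (k+2)) / (4 * h\<^sup>2))"

definition delta1_x :: "real \<Rightarrow> (nat \<Rightarrow> nat \<Rightarrow> real) \<Rightarrow> nat \<Rightarrow> nat \<Rightarrow> real" where
  "delta1_x h \<phi> i j = delta1 h (\<lambda>k. \<phi> k j) i"

definition delta1_y :: "real \<Rightarrow> (nat \<Rightarrow> nat \<Rightarrow> real) \<Rightarrow> nat \<Rightarrow> nat \<Rightarrow> real" where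
  "delta1_y h \<phi> i j = delta1 h (\<lambda>k. \<phi> i k) j"

definition delta2_x :: "real \<Rightarrow> (nat \<Rightarrow> nat \<Rightarrow> real) \<Rightarrow> nat \<Rightarrow> nat \<Rightarrow> real" where
  "delta2_x h \<phi> i j = delta2 h (\<lambda>k. \<phi> k j) i"

definition delta2_y :: "real \<Rightarrow> (nat \<Rightarrow> nat \<Rightarrow> real) \<Rightarrow> nat \<Rightarrow> nat \<Rightarrow> real" where
  "delta2_y h \<phi> i j = delta2 h (\<lambda>k. \<phi> i k) j"

definition scheme_op ::
  "nat \<Rightarrow> real \<Rightarrow> real \<Rightarrow> (nat \<Rightarrow> nat \<Rightarrow> real) \<Rightarrow> (nat \<Rightarrow> nat \<Rightarrow> real)
    \<Rightarrow> (nat \<Rightarrow> nat \<Rightarrow> real) \<Rightarrow> nat \<Rightarrow> nat \<Rightarrow> real" where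
  "scheme_op n \<mu> dt u v \<phi> i j =
    (if (i, j) \<in> interior_points n then
       \<phi> i j + dt * (u i j * delta1_x (mesh_size n) \<phi> i j + v i j * delta1_y (mesh_size n) \<phi> i j
                     - \<mu> * delta2_x (mesh_size n) \<phi> i j - \<mu> * delta2_y (mesh_size n) \<phi> i j)
     else \<phi> i j)"

text \<open>An ordering of the grid points: \<open>p r\<close> is the grid point with number \<open>r\<close>, counted from 0.\<close>

definition grid_ordering :: "nat \<Rightarrow> (nat \<Rightarrow> nat \<times> nat) \<Rightarrow> bool" where
  "grid_ordering n p \<longleftrightarrow> bij_betw p {..<(n+2)^2} (grid_points n)"

definition unit_grid_fun :: "nat \<times> nat \<Rightarrow> nat \<Rightarrow> nat \<Rightarrow> real" where
  "unit_grid_fun q i j = (if (i, j) = q then 1 else 0)"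

text \<open>
  Column \<open>s\<close> holds the image of the unit grid function at \<open>p s\<close>, as usual for the matrix of a
  linear map; see \<open>scheme_matrix_mult_vec\<close> below.
\<close>

definition scheme_matrix ::
  "nat \<Rightarrow> real \<Rightarrow> real \<Rightarrow> (nat \<Rightarrow> nat \<Rightarrow> real) \<Rightarrow> (nat \<Rightarrow> nat \<Rightarrow> real)
    \<Rightarrow> (nat \<Rightarrow> nat \<times> nat) \<Rightarrow> real mat" where
  "scheme_matrix n \<mu> dt u v p =
    mat ((n+2)^2) ((n+2)^2)
      (\<lambda>(r, s). scheme_op n \<mu> dt u v (unit_grid_fun (p s)) (fst (p r)) (snd (p r)))"

definition velocity_max_norm ::
  "nat \<Rightarrow> (nat \<Rightarrow> nat \<Rightarrow> real) \<Rightarrow> (nat \<Rightarrow> nat \<Rightarrow> real) \<Rightarrow> real" where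
  "velocity_max_norm n u v = Max ((\<lambda>(i, j). max \<bar>u i j\<bar> \<bar>v i j\<bar>) ` interior_points n)"

definition inverse_positive :: "real mat \<Rightarrow> bool" where
  "inverse_positive A \<longleftrightarrow>
    invertible_mat A \<and>
    (\<forall>B. inverts_mat A B \<and> inverts_mat B A \<longrightarrow>
         (\<forall>r < dim_row B. \<forall>s < dim_col B. 0 \<le> B $$ (r, s)))"

lemma scheme_op_cong:
  assumes "odd n" and ij: "(i, j) \<in> grid_points n"
    and eq: "\<And>k l. (k, l) \<in> grid_points n \<Longrightarrow> \<phi> k l = \<phi>' k l"
  shows "scheme_op n \<mu> dt u v \<phi> i j = scheme_op n \<mu> dt u v \<phi>' i j"
proof (cases "(i, j) \<in> interior_points n")
  case True
  then have i: "1 \<le> i" "i \<le> n" and j: "1 \<le> j" "j \<le> n"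
    by (auto simp: interior_points_def boundary_points_def grid_points_def)
  have 1: "delta1 h \<psi> k = delta1 h \<psi>' k" "delta2 h \<psi> k = delta2 h \<psi>' k"
    if k: "1 \<le> k" "k \<le> n" and e: "\<And>l. l \<le> n+1 \<Longrightarrow> \<psi> l = \<psi>' l" for h \<psi> \<psi>' k
  proof -
    have "\<psi> k = \<psi>' k" "\<psi> (k-1) = \<psi>' (k-1)" "\<psi> (k+1) = \<psi>' (k+1)" "\<psi> (k-2) = \<psi>' (k-2)"
      using k by (auto intro!: e)
    moreover have "\<psi> (k+2) = \<psi>' (k+2)" if "even k"
    proof -
      have "k \<noteq> n" using that \<open>odd n\<close> by auto
      then show ?thesis using k by (intro e) simp
    qed
    ultimately show "delta1 h \<psi> k = delta1 h \<psi>' k" "delta2 h \<psi> k = delta2 h \<psi>' k"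
      by (simp_all add: delta1_def delta2_def)
  qed
  have x: "\<phi> l j = \<phi>' l j" if "l \<le> n+1" for l using that j by (intro eq) (auto simp: grid_points_def)
  have y: "\<phi> i l = \<phi>' i l" if "l \<le> n+1" for l using that i by (intro eq) (auto simp: grid_points_def)
  show ?thesis
    unfolding scheme_op_def delta1_x_def delta2_x_def delta1_y_def delta2_y_def
    using 1[OF i x] 1[OF j y] eq[OF ij] by simp
next
  case False
  then show ?thesis using eq[OF ij] by (simp add: scheme_op_def)
qed

lemma scheme_op_zero: "scheme_op n \<mu> dt u v (\<lambda>_ _. 0) i j = 0"
  by (simp add: scheme_op_def delta1_x_def delta2_x_def delta1_y_def delta2_y_def
      delta1_def delta2_def)

lemma scheme_op_linear:
  "scheme_op n \<mu> dt u v (\<lambda>i j. a * \<phi> i j + b * \<psi> i j) i j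
    = a * scheme_op n \<mu> dt u v \<phi> i j + b * scheme_op n \<mu> dt u v \<psi> i j"
proof -
  have 1: "delta1 h (\<lambda>k. a * f k + b * g k) k = a * delta1 h f k + b * delta1 h g k" for h f g k
    by (simp add: delta1_def add_divide_distrib diff_divide_distrib algebra_simps)
  have 2: "delta2 h (\<lambda>k. a * f k + b * g k) k = a * delta2 h f k + b * delta2 h g k" for h f g k
    by (simp add: delta2_def add_divide_distrib diff_divide_distrib algebra_simps)
  show ?thesis
    by (simp add: scheme_op_def delta1_x_def delta2_x_def delta1_y_def delta2_y_def 1 2 algebra_simps)
qed

lemma scheme_op_sum:
  assumes "finite S"
  shows "scheme_op n \<mu> dt u v (\<lambda>i j. \<Sum>s\<in>S. c s * f s i j) i j
    = (\<Sum>s\<in>S. c s * scheme_op n \<mu> dt u v (f s) i j)"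
  using assms
proof (induction S rule: finite_induct)
  case empty
  then show ?case by (simp add: scheme_op_zero)
next
  case (insert s S)
  then show ?case
    using scheme_op_linear[of n \<mu> dt u v "c s" "f s" 1 "\<lambda>i j. \<Sum>s\<in>S. c s * f s i j" i j] by simp
qed

lemma scheme_matrix_mult_vec:
  assumes "odd n" and p: "grid_ordering n p"
  shows "scheme_matrix n \<mu> dt u v p *\<^sub>v vec ((n+2)^2) (\<lambda>s. \<phi> (fst (p s)) (snd (p s)))
    = vec ((n+2)^2) (\<lambda>r. scheme_op n \<mu> dt u v \<phi> (fst (p r)) (snd (p r)))"
proof (rule eq_vecI)
  let ?N = "(n+2)^2"
  fix r
  assume "r < dim_vec (vec ?N (\<lambda>r. scheme_op n \<mu> dt u v \<phi> (fst (p r)) (snd (p r))))"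
  then have r: "r < ?N" by simp
  have bij: "bij_betw p {..<?N} (grid_points n)" using p by (simp add: grid_ordering_def)
  have pr: "(fst (p r), snd (p r)) \<in> grid_points n"
    using bij_betwE[OF bij] r by simp
  have exp: "\<phi> k l = (\<Sum>s<?N. \<phi> (fst (p s)) (snd (p s)) * unit_grid_fun (p s) k l)"
    if kl: "(k, l) \<in> grid_points n" for k l
  proof -
    have fin: "finite (grid_points n)" by (simp add: grid_points_def)
    have "(\<Sum>s<?N. \<phi> (fst (p s)) (snd (p s)) * unit_grid_fun (p s) k l)
      = (\<Sum>q\<in>grid_points n. \<phi> (fst q) (snd q) * unit_grid_fun q k l)"
      using sum.reindex_bij_betw[OF bij, of "\<lambda>q. \<phi> (fst q) (snd q) * unit_grid_fun q k l"] .
    also have "\<dots> = (\<Sum>q\<in>grid_points n. if (k, l) = q then \<phi> (fst q) (snd q) else 0)"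
      by (intro sum.cong) (auto simp: unit_grid_fun_def)
    also have "\<dots> = \<phi> k l" using kl fin by (simp add: sum.delta')
    finally show ?thesis by simp
  qed
  have "scheme_op n \<mu> dt u v \<phi> (fst (p r)) (snd (p r))
    = scheme_op n \<mu> dt u v (\<lambda>k l. \<Sum>s<?N. \<phi> (fst (p s)) (snd (p s)) * unit_grid_fun (p s) k l)
        (fst (p r)) (snd (p r))"
    by (rule scheme_op_cong[OF \<open>odd n\<close> pr exp])
  also have "\<dots> = (\<Sum>s<?N. \<phi> (fst (p s)) (snd (p s))
      * scheme_op n \<mu> dt u v (unit_grid_fun (p s)) (fst (p r)) (snd (p r)))"
    by (rule scheme_op_sum) simp
  finally show "(scheme_matrix n \<mu> dt u v p *\<^sub>v vec ?N (\<lambda>s. \<phi> (fst (p s)) (snd (p s)))) $ r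
    = vec ?N (\<lambda>r. scheme_op n \<mu> dt u v \<phi> (fst (p r)) (snd (p r))) $ r"
    using r by (simp add: scheme_matrix_def scalar_prod_def atLeast0LessThan mult.commute)
qed (simp add: scheme_matrix_def)

end

theory Submission
  imports Defs "Jordan_Normal_Form.Determinant"
begin

text \<open>
  Lorenz's method. Write \<open>\<lambda> = dt * \<mu> / h\<^sup>2\<close> and
  \<open>a = h * U / (2 * \<mu>)\<close>. The only positive off-diagonal entries of the matrix \<open>L\<close> are the
  couplings of a point with even index to the points two steps away in that direction. Let \<open>M\<close>
  keep of \<open>L\<close> the diagonal, and the off-diagonal couplings in those directions in which the index
  is odd; it is a strictly diagonally dominant M-matrix. Each positive coupling is dominated by a
  path of two negative ones, from the even point to the odd point in between by \<open>L - M\<close> and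
  further by \<open>M\<close>, as soon as \<open>1 + 2 * a \<le> \<lambda> * (5/2 - 11 * a - 8 * a\<^sup>2)\<close>; the worst case is
  a middle point with an even transversal index, whose diagonal entry is \<open>1 + 11/2 * \<lambda>\<close>.
  The row sums of \<open>L\<close> being 1, \<open>L \<phi> \<ge> 0\<close> then implies \<open>\<phi> \<ge> 0\<close>. All four conditions of the
  theorem imply the displayed inequality.
\<close>

section \<open>Monotonicity and inverse positive matrices\<close>

text \<open>Monotonicity applied to \<open>x\<close> and \<open>- x\<close> makes the kernel
  trivial. A column of an inverse is mapped to a unit vector, so monotonicity applies to it as
  well.\<close>

lemma inverse_positive_if_monotone:
  assumes A: "A \<in> carrier_mat N N"
    and mono: "\<And>x. x \<in> carrier_vec N \<Longrightarrow> (\<And>r. r < N \<Longrightarrow> 0 \<le> (A *\<^sub>v x) $ r) \<Longrightarrow> \<forall>r<N. 0 \<le> x $ r"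
  shows "inverse_positive A"
proof -
  have "x = 0\<^sub>v N" if x: "x \<in> carrier_vec N" and Ax: "A *\<^sub>v x = 0\<^sub>v N" for x
  proof -
    have "A *\<^sub>v (- x) = - (A *\<^sub>v x)" using A x by (intro eq_vecI) auto
    then have "A *\<^sub>v (- x) = 0\<^sub>v N" using Ax by simp
    then have "\<forall>r<N. 0 \<le> (- x) $ r" by (intro mono) (use x in auto)
    moreover have "\<forall>r<N. 0 \<le> x $ r" by (intro mono) (use x Ax in auto)
    ultimately show ?thesis using x by (auto intro!: eq_vecI simp: order_antisym)
  qed
  then have "det A \<noteq> 0" using det_0_iff_vec_prod_zero[OF A] by blast
  then have "A \<in> Units (ring_mat TYPE(real) N ())" by (rule det_non_zero_imp_unit[OF A])
  then obtain B where "B \<in> carrier_mat N N" "A * B = 1\<^sub>m N" "B * A = 1\<^sub>m N"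
    unfolding Units_def ring_mat_def by auto
  then have "invertible_mat A"
    using A by (auto simp: invertible_mat_def inverts_mat_def)
  moreover have "0 \<le> B $$ (r, s)"
    if "inverts_mat A B" "inverts_mat B A" and r: "r < dim_row B" and s: "s < dim_col B" for B r s
  proof -
    have AB: "A * B = 1\<^sub>m N" and BA: "B * A = 1\<^sub>m (dim_row B)"
      using that A by (auto simp: inverts_mat_def)
    \<comment> \<open>\<open>inverse_positive\<close> leaves the dimensions of \<open>B\<close>
      open; the two identities determine them.\<close>
    have "dim_col B = N" using arg_cong[OF AB, of dim_col] by simp
    moreover have "dim_row B = N" using arg_cong[OF BA, of dim_col] A by simp
    ultimately have B: "B \<in> carrier_mat N N" by auto
    have "A *\<^sub>v col B s = unit_vec N s"
      using col_mult2[OF A B, of s] AB s B by simp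
    then have "\<forall>r<N. 0 \<le> col B s $ r"
      using B s by (intro mono) (auto simp: unit_vec_def)
    then show ?thesis using B r s by auto
  qed
  ultimately show ?thesis by (auto simp: inverse_positive_def)
qed

text \<open>
  If \<open>L = K M\<close>, then \<open>touch\<close> expresses that \<open>K\<close> has nonpositive off-diagonal entries. The proof
  shifts \<open>\<phi>\<close> by the constant that makes the minimum of \<open>M \<phi> / m\<close> vanish, so that neither \<open>K\<close>
  nor the inverse of \<open>M\<close> is needed.
\<close>

lemma monotone_if_factor_monotone:
  fixes L M :: "('a \<Rightarrow> real) \<Rightarrow> 'a \<Rightarrow> real"
  assumes "finite S"
    and L_shift: "\<And>\<phi> t q. q \<in> S \<Longrightarrow> L (\<lambda>x. \<phi> x + t) q = L \<phi> q + t * l q"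
    and l_pos: "\<And>q. q \<in> S \<Longrightarrow> 0 < l q"
    and M_shift: "\<And>\<phi> t q. q \<in> S \<Longrightarrow> M (\<lambda>x. \<phi> x + t) q = M \<phi> q + t * m q"
    and m_pos: "\<And>q. q \<in> S \<Longrightarrow> 0 < m q"
    and M_mono: "\<And>\<phi> q. (\<And>q. q \<in> S \<Longrightarrow> 0 \<le> M \<phi> q) \<Longrightarrow> q \<in> S \<Longrightarrow> 0 \<le> \<phi> q"
    and touch: "\<And>\<phi> r. (\<And>q. q \<in> S \<Longrightarrow> 0 \<le> \<phi> q) \<Longrightarrow> (\<And>q. q \<in> S \<Longrightarrow> 0 \<le> M \<phi> q)
      \<Longrightarrow> r \<in> S \<Longrightarrow> M \<phi> r = 0 \<Longrightarrow> L \<phi> r \<le> 0"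
    and L_nonneg: "\<And>q. q \<in> S \<Longrightarrow> 0 \<le> L \<phi> q"
    and "q \<in> S"
  shows "0 \<le> \<phi> q"
proof (rule M_mono[OF ccontr \<open>q \<in> S\<close>])
  fix p assume p: "p \<in> S" "\<not> 0 \<le> M \<phi> p"
  define f where "f q = - M \<phi> q / m q" for q
  define t where "t = Max (f ` S)"
  have f_le: "f q \<le> t" if "q \<in> S" for q
    unfolding t_def using \<open>finite S\<close> that by (intro Max_ge) auto
  have "t \<in> f ` S" unfolding t_def using \<open>finite S\<close> p by (intro Max_in) auto
  then obtain r where r: "r \<in> S" "t = f r" by auto
  have "0 < f p" using p m_pos[of p] by (simp add: f_def divide_neg_pos)
  then have t: "0 < t" using f_le[OF \<open>p \<in> S\<close>] by linarith
  define \<chi> where "\<chi> x = \<phi> x + t" for x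
  have M\<chi>: "0 \<le> M \<chi> q" if "q \<in> S" for q
    using f_le[OF that] m_pos[OF that] M_shift[OF that, of \<phi> t]
    unfolding \<chi>_def[abs_def] f_def by (simp add: field_simps)
  have "M \<chi> r = 0"
    using r m_pos[of r] M_shift[OF \<open>r \<in> S\<close>, of \<phi> t] unfolding \<chi>_def[abs_def] f_def by simp
  \<comment> \<open>Since \<open>t\<close> is positive, the shift strictly raises
    \<open>L \<phi> r\<close>, which is already nonnegative; this contradicts \<open>touch\<close>
    at \<open>r\<close>.\<close>
  then have "L \<chi> r \<le> 0" using M\<chi> M_mono[OF M\<chi>] r by (intro touch) auto
  moreover have "L \<chi> r = L \<phi> r + t * l r" unfolding \<chi>_def[abs_def] using r by (intro L_shift)
  moreover have "0 < t * l r" using t l_pos r by simp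
  ultimately show False using L_nonneg[of r] r by simp
qed

section \<open>The one-dimensional stencils\<close>

text \<open>
  The one-dimensional part of the scheme, divided by \<open>\<mu> / h\<^sup>2\<close>; \<open>\<alpha>\<close> is half the cell Peclet
  number \<open>h * w / \<mu>\<close> of the velocity component \<open>w\<close>.
\<close>

definition conv_diff :: "real \<Rightarrow> (nat \<Rightarrow> real) \<Rightarrow> nat \<Rightarrow> real" where
  "conv_diff \<alpha> \<psi> k =
    (if odd k then 2 * \<psi> k - (1 + \<alpha>) * \<psi> (k-1) - (1 - \<alpha>) * \<psi> (k+1)
     else 7/2 * \<psi> k - (2 + 2 * \<alpha>) * \<psi> (k-1) - (2 - 2 * \<alpha>) * \<psi> (k+1)
       + (1/4 + \<alpha>/2) * \<psi> (k-2) + (1/4 - \<alpha>/2) * \<psi> (k+2))"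

text \<open>The share of one direction in \<open>M\<close>; 7/2 is the diagonal weight of the even
  stencil.\<close>

definition conv_diff_odd :: "real \<Rightarrow> (nat \<Rightarrow> real) \<Rightarrow> nat \<Rightarrow> real" where
  "conv_diff_odd \<alpha> \<psi> k = (if odd k then conv_diff \<alpha> \<psi> k else 7/2 * \<psi> k)"

lemma delta_eq_conv_diff:
  assumes "h > 0" "\<mu> > 0"
  shows "w * delta1 h \<psi> k - \<mu> * delta2 h \<psi> k = \<mu> / h\<^sup>2 * conv_diff (h * w / (2 * \<mu>)) \<psi> k"
  using assms
  by (cases "odd k") (simp_all add: delta1_def delta2_def conv_diff_def field_simps power2_eq_square)

text \<open>\<open>Y\<close> is the value two steps from an even point and \<open>X\<close> the
  value at the odd point in between. \<open>XY\<close> is what nonnegativity of \<open>M\<close> at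
  the odd point yields; the near coupling then absorbs the positive far one.\<close>

lemma path_dominates_far_neighbour:
  fixes a \<alpha> lam X Y :: real
  assumes "0 \<le> a" "0 < lam" and cond: "1 + 2 * a \<le> lam * (5/2 - 11 * a - 8 * a\<^sup>2)"
    and \<alpha>: "\<bar>\<alpha>\<bar> \<le> a" and "0 \<le> Y" and XY: "lam * (1 - a) * Y \<le> (1 + 11/2 * lam) * X"
  shows "(1/4 - \<alpha>/2) * Y \<le> (2 - 2 * \<alpha>) * X"
proof -
  have "0 < lam * (5/2 - 11 * a - 8 * a\<^sup>2)" using cond \<open>0 \<le> a\<close> by linarith
  then have "0 < 5/2 - 11 * a - 8 * a\<^sup>2" using \<open>0 < lam\<close> by (simp add: zero_less_mult_iff)
  then have a: "a < 1/2" using zero_le_power2[of a] by linarith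
  \<comment> \<open>The inequality below is affine in \<open>\<alpha>\<close> with slope \<open>2 + 3 * lam + 8 * lam * a\<close> (right minus
    left), and at \<open>\<alpha> = - a\<close> it is \<open>cond\<close>.\<close>
  have "0 \<le> (a + \<alpha>) * (2 + 3 * lam + 8 * lam * a)"
    using \<open>\<bar>\<alpha>\<bar> \<le> a\<close>[THEN abs_le_D2] \<open>0 \<le> a\<close> \<open>0 < lam\<close> by (intro mult_nonneg_nonneg) auto
  then have "(1 - 2 * \<alpha>) * (1 + 11/2 * lam) \<le> 8 * (1 - \<alpha>) * (1 - a) * lam"
    using cond by (simp add: field_simps power2_eq_square)
  from mult_right_mono[OF this \<open>0 \<le> Y\<close>]
  have "(1 + 11/2 * lam) * ((1/4 - \<alpha>/2) * Y) \<le> (2 - 2 * \<alpha>) * (lam * (1 - a) * Y)"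
    by (simp add: field_simps)
  also have "\<dots> \<le> (2 - 2 * \<alpha>) * ((1 + 11/2 * lam) * X)"
    using XY \<alpha> a by (intro mult_left_mono) auto
  finally have "(1 + 11/2 * lam) * ((1/4 - \<alpha>/2) * Y) \<le> (1 + 11/2 * lam) * ((2 - 2 * \<alpha>) * X)"
    by (simp add: mult.left_commute)
  then show ?thesis using \<open>0 < lam\<close> by (simp only: mult_le_cancel_left)
qed

text \<open>At even \<open>k\<close>, each far term is absorbed by the near term on the same side,
  which leaves only the diagonal.\<close>

lemma conv_diff_le_odd_part:
  fixes a \<alpha> lam :: real and \<psi> :: "nat \<Rightarrow> real"
  assumes "0 \<le> a" "0 < lam" "1 + 2 * a \<le> lam * (5/2 - 11 * a - 8 * a\<^sup>2)" "\<bar>\<alpha>\<bar> \<le> a"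
    and nbr: "even k \<Longrightarrow> 0 \<le> \<psi> (k-2)" "even k \<Longrightarrow> 0 \<le> \<psi> (k+2)"
    and "even k \<Longrightarrow> lam * (1 - a) * \<psi> (k-2) \<le> (1 + 11/2 * lam) * \<psi> (k-1)"
    and "even k \<Longrightarrow> lam * (1 - a) * \<psi> (k+2) \<le> (1 + 11/2 * lam) * \<psi> (k+1)"
  shows "conv_diff \<alpha> \<psi> k \<le> conv_diff_odd \<alpha> \<psi> k"
proof (cases "odd k")
  case False
  \<comment> \<open>The left side is the right side with the velocity reversed.\<close>
  have "(1/4 - (- \<alpha>)/2) * \<psi> (k-2) \<le> (2 - 2 * (- \<alpha>)) * \<psi> (k-1)"
    using False assms by (intro path_dominates_far_neighbour[of a lam]) auto
  moreover have "(1/4 - \<alpha>/2) * \<psi> (k+2) \<le> (2 - 2 * \<alpha>) * \<psi> (k+1)"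
    using False assms by (intro path_dominates_far_neighbour[of a lam]) auto
  ultimately show ?thesis using False by (simp add: conv_diff_def conv_diff_odd_def)
qed (simp add: conv_diff_odd_def)

text \<open>The neighbours enter with nonpositive weights, and 7/2 is the larger of the diagonal
  weights 2 and 7/2.\<close>

lemma conv_diff_odd_le:
  assumes "\<bar>\<alpha>\<bar> \<le> 1" "0 \<le> \<psi> (k-1)" "0 \<le> \<psi> k" "0 \<le> \<psi> (k+1)"
  shows "conv_diff_odd \<alpha> \<psi> k \<le> 7/2 * \<psi> k"
proof -
  have "0 \<le> (1 + \<alpha>) * \<psi> (k-1)" "0 \<le> (1 - \<alpha>) * \<psi> (k+1)" using assms by auto
  then have "2 * \<psi> k - (1 + \<alpha>) * \<psi> (k-1) - (1 - \<alpha>) * \<psi> (k+1) \<le> 7/2 * \<psi> k"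
    using assms by linarith
  then show ?thesis by (simp add: conv_diff_odd_def conv_diff_def)
qed

text \<open>Supplies \<open>XY\<close> above. Here \<open>c\<close> stands for the transversal
  direction: its bound 7/2 and the diagonal weight 2 add up to 11/2. Each claim drops the other
  neighbour and lowers the weight of the remaining one to \<open>1 - a\<close>.\<close>

lemma conv_diff_odd_neighbour:
  fixes \<psi> :: "nat \<Rightarrow> real"
  assumes "0 < lam" "a \<le> 1" "\<bar>\<alpha>\<bar> \<le> a" "odd k"
    and nonneg: "0 \<le> \<psi> (k-1)" "0 \<le> \<psi> (k+1)"
    and "c \<le> 7/2 * \<psi> k" "0 \<le> \<psi> k + lam * (conv_diff_odd \<alpha> \<psi> k + c)"
  shows "lam * (1 - a) * \<psi> (k-1) \<le> (1 + 11/2 * lam) * \<psi> k"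
    and "lam * (1 - a) * \<psi> (k+1) \<le> (1 + 11/2 * lam) * \<psi> k"
proof -
  have "(1 - a) * \<psi> (k-1) \<le> (1 + \<alpha>) * \<psi> (k-1)" "(1 - a) * \<psi> (k+1) \<le> (1 - \<alpha>) * \<psi> (k+1)"
    "0 \<le> (1 - a) * \<psi> (k-1)" "0 \<le> (1 - a) * \<psi> (k+1)"
    using assms by (auto intro!: mult_right_mono)
  moreover have "conv_diff_odd \<alpha> \<psi> k = 2 * \<psi> k - (1 + \<alpha>) * \<psi> (k-1) - (1 - \<alpha>) * \<psi> (k+1)"
    using \<open>odd k\<close> by (simp add: conv_diff_odd_def conv_diff_def)
  ultimately have "conv_diff_odd \<alpha> \<psi> k + c \<le> 11/2 * \<psi> k - (1 - a) * \<psi> (k-1)"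
    "conv_diff_odd \<alpha> \<psi> k + c \<le> 11/2 * \<psi> k - (1 - a) * \<psi> (k+1)"
    using \<open>c \<le> 7/2 * \<psi> k\<close> by linarith+
  from this[THEN mult_left_mono, of lam] assms
  show "lam * (1 - a) * \<psi> (k-1) \<le> (1 + 11/2 * lam) * \<psi> k"
    and "lam * (1 - a) * \<psi> (k+1) \<le> (1 + 11/2 * lam) * \<psi> k"
    by (auto simp: algebra_simps)
qed

lemma conv_diff_shift: "conv_diff \<alpha> (\<lambda>k. \<psi> k + t) k = conv_diff \<alpha> \<psi> k"
  by (cases "odd k") (simp_all add: conv_diff_def field_simps)

lemma conv_diff_odd_shift:
  "conv_diff_odd \<alpha> (\<lambda>k. \<psi> k + t) k = conv_diff_odd \<alpha> \<psi> k + (if odd k then 0 else 7/2 * t)"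
  by (simp add: conv_diff_odd_def conv_diff_shift distrib_left)

section \<open>The factor \<open>M\<close> on the grid\<close>

definition lorenz_factor ::
  "nat \<Rightarrow> real \<Rightarrow> (nat \<Rightarrow> nat \<Rightarrow> real) \<Rightarrow> (nat \<Rightarrow> nat \<Rightarrow> real)
    \<Rightarrow> (nat \<times> nat \<Rightarrow> real) \<Rightarrow> nat \<times> nat \<Rightarrow> real" where
  "lorenz_factor n lam \<alpha> \<beta> \<phi> = (\<lambda>(i, j).
    if (i, j) \<in> interior_points n then
      \<phi> (i, j) + lam * (conv_diff_odd (\<alpha> i j) (\<lambda>k. \<phi> (k, j)) i + conv_diff_odd (\<beta> i j) (\<lambda>k. \<phi> (i, k)) j)
    else \<phi> (i, j))"

lemma interior_points_iff: "(i, j) \<in> interior_points n \<longleftrightarrow> 1 \<le> i \<and> i \<le> n \<and> 1 \<le> j \<and> j \<le> n"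
  by (auto simp: interior_points_def boundary_points_def grid_points_def)

lemma grid_points_iff: "(i, j) \<in> grid_points n \<longleftrightarrow> i \<le> n + 1 \<and> j \<le> n + 1"
  by (auto simp: grid_points_def)

text \<open>The coefficient of \<open>t\<close> is the row sum of \<open>M\<close>: the odd stencil
  has row sum 0, and an even direction contributes its bare diagonal.\<close>

lemma lorenz_factor_shift:
  "lorenz_factor n lam \<alpha> \<beta> (\<lambda>x. \<phi> x + t) q = lorenz_factor n lam \<alpha> \<beta> \<phi> q
    + t * (if q \<in> interior_points n then
        1 + lam * ((if odd (fst q) then 0 else 7/2) + (if odd (snd q) then 0 else 7/2)) else 1)"
  by (cases q) (auto simp: lorenz_factor_def conv_diff_odd_shift; simp add: algebra_simps)

text \<open>An instance of \<open>monotone_if_factor_monotone\<close> with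
  \<open>lorenz_factor\<close> as \<open>L\<close> and the identity as \<open>M\<close>: where a
  nonnegative function vanishes, \<open>conv_diff_odd_le\<close> bounds each direction by 0.\<close>

lemma lorenz_factor_monotone:
  assumes "0 < lam"
    and \<alpha>: "\<And>i j. (i, j) \<in> interior_points n \<Longrightarrow> \<bar>\<alpha> i j\<bar> \<le> 1"
    and \<beta>: "\<And>i j. (i, j) \<in> interior_points n \<Longrightarrow> \<bar>\<beta> i j\<bar> \<le> 1"
    and nonneg: "\<And>q. q \<in> grid_points n \<Longrightarrow> 0 \<le> lorenz_factor n lam \<alpha> \<beta> \<phi> q"
    and q: "q \<in> grid_points n"
  shows "0 \<le> \<phi> q"
proof (rule monotone_if_factor_monotone[where S = "grid_points n" and \<phi> = \<phi>
      and M = "\<lambda>\<phi>. \<phi>" and m = "\<lambda>_. 1", OF _ lorenz_factor_shift])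
  show "0 < (if q \<in> interior_points n then
      1 + lam * ((if odd (fst q) then 0 else 7/2) + (if odd (snd q) then 0 else 7/2)) else 1)" for q
    using \<open>0 < lam\<close> by (auto simp: add_pos_pos)
next
  fix \<phi> :: "nat \<times> nat \<Rightarrow> real" and r
  assume \<phi>: "\<And>q. q \<in> grid_points n \<Longrightarrow> 0 \<le> \<phi> q" and r: "r \<in> grid_points n" "\<phi> r = 0"
  obtain i j where ij: "r = (i, j)" by (cases r)
  show "lorenz_factor n lam \<alpha> \<beta> \<phi> r \<le> 0"
  proof (cases "r \<in> interior_points n")
    case True
    have "conv_diff_odd (\<alpha> i j) (\<lambda>k. \<phi> (k, j)) i \<le> 7/2 * \<phi> (i, j)"
      using True \<alpha>[of i j]
      by (intro conv_diff_odd_le \<phi>) (auto simp: ij interior_points_iff grid_points_iff)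
    moreover have "conv_diff_odd (\<beta> i j) (\<lambda>k. \<phi> (i, k)) j \<le> 7/2 * \<phi> (i, j)"
      using True \<beta>[of i j]
      by (intro conv_diff_odd_le \<phi>) (auto simp: ij interior_points_iff grid_points_iff)
    ultimately have "conv_diff_odd (\<alpha> i j) (\<lambda>k. \<phi> (k, j)) i + conv_diff_odd (\<beta> i j) (\<lambda>k. \<phi> (i, k)) j \<le> 0"
      using r ij by simp
    then show ?thesis using True r ij \<open>0 < lam\<close> by (simp add: lorenz_factor_def mult_nonneg_nonpos)
  qed (use r ij in \<open>simp add: lorenz_factor_def\<close>)
qed (use q nonneg in \<open>auto simp: grid_points_def\<close>)

section \<open>Monotonicity of the scheme and its matrix\<close>

lemma scheme_op_eq_conv_diff:
  fixes n :: nat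
  assumes "\<mu> > 0"
  defines "h \<equiv> mesh_size n"
  shows "scheme_op n \<mu> dt u v \<phi> i j =
    (if (i, j) \<in> interior_points n then
      \<phi> i j + dt * (\<mu> / h\<^sup>2) * (conv_diff (h * u i j / (2 * \<mu>)) (\<lambda>k. \<phi> k j) i
        + conv_diff (h * v i j / (2 * \<mu>)) (\<lambda>k. \<phi> i k) j)
     else \<phi> i j)"
proof -
  have "h > 0" by (simp add: h_def mesh_size_def)
  note e = delta_eq_conv_diff[OF this \<open>\<mu> > 0\<close>]
  show ?thesis
    using e[of "u i j" "\<lambda>k. \<phi> k j" i] e[of "v i j" "\<lambda>k. \<phi> i k" j]
    by (simp add: scheme_op_def delta1_x_def delta2_x_def delta1_y_def delta2_y_def
        flip: h_def distrib_left mult.assoc) (simp add: algebra_simps add_divide_distrib)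
qed

text \<open>Whenever \<open>\<chi>\<close> and \<open>M \<chi>\<close> are nonnegative on the grid,
  \<open>L \<chi> \<le> M \<chi>\<close> holds there, direction by direction; this yields
  \<open>touch\<close>.\<close>

lemma scheme_op_monotone:
  fixes n :: nat
  assumes "odd n" "\<mu> > 0" "dt > 0" and "0 \<le> a"
  defines "h \<equiv> mesh_size n"
  assumes u: "\<And>i j. (i, j) \<in> interior_points n \<Longrightarrow> \<bar>h * u i j / (2 * \<mu>)\<bar> \<le> a"
    and v: "\<And>i j. (i, j) \<in> interior_points n \<Longrightarrow> \<bar>h * v i j / (2 * \<mu>)\<bar> \<le> a"
    and cond: "1 + 2 * a \<le> dt * (\<mu> / h\<^sup>2) * (5/2 - 11 * a - 8 * a\<^sup>2)"
    and nonneg: "\<And>i j. (i, j) \<in> grid_points n \<Longrightarrow> 0 \<le> scheme_op n \<mu> dt u v \<phi> i j"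
    and ij: "(i, j) \<in> grid_points n"
  shows "0 \<le> \<phi> i j"
proof -
  define lam where "lam = dt * (\<mu> / h\<^sup>2)"
  define \<alpha> where "\<alpha> i j = h * u i j / (2 * \<mu>)" for i j
  define \<beta> where "\<beta> i j = h * v i j / (2 * \<mu>)" for i j
  have "h > 0" by (simp add: h_def mesh_size_def)
  then have lam: "0 < lam" using \<open>\<mu> > 0\<close> \<open>dt > 0\<close> by (simp add: lam_def)
  note op = scheme_op_eq_conv_diff[OF \<open>\<mu> > 0\<close>, where n = n and dt = dt and u = u and v = v,
      folded h_def, folded lam_def \<alpha>_def \<beta>_def]
  note \<alpha> = u[folded \<alpha>_def] and \<beta> = v[folded \<beta>_def] and cond = cond[folded lam_def]
  \<comment> \<open>The bound \<open>a \<le> 1\<close> obtained here keeps the weights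
    \<open>1 + \<alpha>\<close> and \<open>1 - \<alpha>\<close> in \<open>M\<close>
    nonnegative.\<close>
  have "0 < lam * (5/2 - 11 * a - 8 * a\<^sup>2)" using cond \<open>0 \<le> a\<close> by linarith
  then have "0 < 5/2 - 11 * a - 8 * a\<^sup>2" using lam by (simp add: zero_less_mult_iff)
  then have a: "a \<le> 1" using zero_le_power2[of a] by linarith
  let ?L = "\<lambda>\<phi> q. scheme_op n \<mu> dt u v (\<lambda>i j. \<phi> (i, j)) (fst q) (snd q)"
  let ?M = "lorenz_factor n lam \<alpha> \<beta>"
  have "0 \<le> (\<lambda>(i, j). \<phi> i j) (i, j)"
  proof (rule monotone_if_factor_monotone[where S = "grid_points n" and L = ?L
        and l = "\<lambda>_. 1" and \<phi> = "\<lambda>(i, j). \<phi> i j", OF _ _ _ lorenz_factor_shift])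
    show "0 < (if q \<in> interior_points n then
        1 + lam * ((if odd (fst q) then 0 else 7/2) + (if odd (snd q) then 0 else 7/2)) else 1)" for q
      using lam by (auto simp: add_pos_pos)
    show "?L (\<lambda>x. \<phi> x + t) q = ?L \<phi> q + t * 1" for \<phi> t q
      by (simp add: op conv_diff_shift)
    show "0 \<le> \<phi> q" if "\<And>q. q \<in> grid_points n \<Longrightarrow> 0 \<le> ?M \<phi> q" "q \<in> grid_points n" for \<phi> q
      by (intro lorenz_factor_monotone[OF lam _ _ that] order_trans[OF \<alpha> a] order_trans[OF \<beta> a])
  next
    fix \<chi> :: "nat \<times> nat \<Rightarrow> real" and r
    assume \<chi>: "\<And>q. q \<in> grid_points n \<Longrightarrow> 0 \<le> \<chi> q" and M\<chi>: "\<And>q. q \<in> grid_points n \<Longrightarrow> 0 \<le> ?M \<chi> q"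
      and r: "r \<in> grid_points n" "?M \<chi> r = 0"
    obtain i j where ij: "r = (i, j)" by (cases r)
    \<comment> \<open>Here \<open>c\<close> is the \<open>y\<close> part, bounded by
      \<open>conv_diff_odd_le\<close> for either parity of \<open>l\<close>.\<close>
    have x_nbr: "lam * (1 - a) * \<chi> (k-1, l) \<le> (1 + 11/2 * lam) * \<chi> (k, l)"
      "lam * (1 - a) * \<chi> (k+1, l) \<le> (1 + 11/2 * lam) * \<chi> (k, l)"
      if kl: "(k, l) \<in> interior_points n" "odd k" for k l
    proof -
      have "conv_diff_odd (\<beta> k l) (\<lambda>j. \<chi> (k, j)) l \<le> 7/2 * \<chi> (k, l)"
        using kl \<beta>[of k l] a by (intro conv_diff_odd_le \<chi>) (auto simp: interior_points_iff grid_points_iff)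
      moreover have "0 \<le> ?M \<chi> (k, l)"
        using kl by (intro M\<chi>) (auto simp: interior_points_iff grid_points_iff)
      ultimately show "lam * (1 - a) * \<chi> (k-1, l) \<le> (1 + 11/2 * lam) * \<chi> (k, l)"
        "lam * (1 - a) * \<chi> (k+1, l) \<le> (1 + 11/2 * lam) * \<chi> (k, l)"
        using conv_diff_odd_neighbour[where \<psi> = "\<lambda>i. \<chi> (i, l)", OF lam a \<alpha>[OF kl(1)] kl(2)]
          \<chi>[of "(k-1, l)"] \<chi>[of "(k+1, l)"] kl
        by (auto simp: lorenz_factor_def interior_points_iff grid_points_iff)
    qed
    have y_nbr: "lam * (1 - a) * \<chi> (k, l-1) \<le> (1 + 11/2 * lam) * \<chi> (k, l)"
      "lam * (1 - a) * \<chi> (k, l+1) \<le> (1 + 11/2 * lam) * \<chi> (k, l)"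
      if kl: "(k, l) \<in> interior_points n" "odd l" for k l
    proof -
      have "conv_diff_odd (\<alpha> k l) (\<lambda>i. \<chi> (i, l)) k \<le> 7/2 * \<chi> (k, l)"
        using kl \<alpha>[of k l] a by (intro conv_diff_odd_le \<chi>) (auto simp: interior_points_iff grid_points_iff)
      moreover have "0 \<le> ?M \<chi> (k, l)"
        using kl by (intro M\<chi>) (auto simp: interior_points_iff grid_points_iff)
      ultimately show "lam * (1 - a) * \<chi> (k, l-1) \<le> (1 + 11/2 * lam) * \<chi> (k, l)"
        "lam * (1 - a) * \<chi> (k, l+1) \<le> (1 + 11/2 * lam) * \<chi> (k, l)"
        using conv_diff_odd_neighbour[where \<psi> = "\<lambda>j. \<chi> (k, j)", OF lam a \<beta>[OF kl(1)] kl(2)]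
          \<chi>[of "(k, l-1)"] \<chi>[of "(k, l+1)"] kl
        by (auto simp: lorenz_factor_def interior_points_iff grid_points_iff add.commute)
    qed
    show "?L \<chi> r \<le> 0"
    proof (cases "r \<in> interior_points n")
      case True
      then have b: "1 \<le> i" "i \<le> n" "1 \<le> j" "j \<le> n" by (auto simp: ij interior_points_iff)
      \<comment> \<open>As \<open>n\<close> is odd, an even interior index lies between 2 and
        \<open>n - 1\<close>. So the far neighbours are grid points and the near ones are interior,
        where \<open>x_nbr\<close> and \<open>y_nbr\<close> apply.\<close>
      have even_less: "k \<ge> 2 \<and> k + 1 \<le> n" if "even k" "1 \<le> k" "k \<le> n" for k
        using that \<open>odd n\<close> by (cases "k = n"; cases "k = 1") auto
      have "conv_diff (\<alpha> i j) (\<lambda>k. \<chi> (k, j)) i \<le> conv_diff_odd (\<alpha> i j) (\<lambda>k. \<chi> (k, j)) i"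
      proof (rule conv_diff_le_odd_part[OF \<open>0 \<le> a\<close> lam cond])
        assume "even i"
        note i = this even_less[OF this b(1,2)]
        have inner: "(i - 1, j) \<in> interior_points n" using i b by (simp add: interior_points_iff) linarith
        from i show "0 \<le> \<chi> (i - 2, j)" "0 \<le> \<chi> (i + 2, j)"
          using b by (auto intro!: \<chi> simp: grid_points_iff)
        show "lam * (1 - a) * \<chi> (i - 2, j) \<le> (1 + 11/2 * lam) * \<chi> (i - 1, j)"
          using x_nbr(1)[of "i - 1" j] i inner by (auto simp flip: numeral_2_eq_2)
        show "lam * (1 - a) * \<chi> (i + 2, j) \<le> (1 + 11/2 * lam) * \<chi> (i + 1, j)"
          using x_nbr(2)[of "i + 1" j] i b by (auto simp: interior_points_iff)
      qed (use True \<alpha>[of i j] ij in simp)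
      moreover have "conv_diff (\<beta> i j) (\<lambda>k. \<chi> (i, k)) j \<le> conv_diff_odd (\<beta> i j) (\<lambda>k. \<chi> (i, k)) j"
      proof (rule conv_diff_le_odd_part[OF \<open>0 \<le> a\<close> lam cond])
        assume "even j"
        note j = this even_less[OF this b(3,4)]
        have inner: "(i, j - 1) \<in> interior_points n" using j b by (simp add: interior_points_iff) linarith
        from j show "0 \<le> \<chi> (i, j - 2)" "0 \<le> \<chi> (i, j + 2)"
          using b by (auto intro!: \<chi> simp: grid_points_iff)
        show "lam * (1 - a) * \<chi> (i, j - 2) \<le> (1 + 11/2 * lam) * \<chi> (i, j - 1)"
          using y_nbr(1)[of i "j - 1"] j inner by (auto simp flip: numeral_2_eq_2)
        show "lam * (1 - a) * \<chi> (i, j + 2) \<le> (1 + 11/2 * lam) * \<chi> (i, j + 1)"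
          using y_nbr(2)[of i "j + 1"] j b by (auto simp: interior_points_iff)
      qed (use True \<beta>[of i j] ij in simp)
      ultimately have "?L \<chi> (i, j) \<le> ?M \<chi> (i, j)"
        using True ij lam by (simp add: op lorenz_factor_def)
      then show ?thesis using r ij by simp
    qed (use r ij in \<open>simp add: op lorenz_factor_def\<close>)
  qed (use ij nonneg in \<open>auto simp: grid_points_def\<close>)
  then show ?thesis by simp
qed

lemma scheme_matrix_inverse_positive:
  fixes n :: nat
  assumes "odd n" "\<mu> > 0" "dt > 0" "grid_ordering n p" and "0 \<le> a"
  defines "h \<equiv> mesh_size n"
  assumes "\<And>i j. (i, j) \<in> interior_points n \<Longrightarrow> \<bar>h * u i j / (2 * \<mu>)\<bar> \<le> a"
    and "\<And>i j. (i, j) \<in> interior_points n \<Longrightarrow> \<bar>h * v i j / (2 * \<mu>)\<bar> \<le> a"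
    and "1 + 2 * a \<le> dt * (\<mu> / h\<^sup>2) * (5/2 - 11 * a - 8 * a\<^sup>2)"
  shows "inverse_positive (scheme_matrix n \<mu> dt u v p)"
proof (rule inverse_positive_if_monotone)
  let ?N = "(n+2)^2" and ?A = "scheme_matrix n \<mu> dt u v p"
  show "?A \<in> carrier_mat ?N ?N" by (simp add: scheme_matrix_def)
  have bij: "bij_betw p {..<?N} (grid_points n)" using assms(4) by (simp add: grid_ordering_def)
  fix x assume x: "x \<in> carrier_vec ?N" and nonneg: "\<And>r. r < ?N \<Longrightarrow> 0 \<le> (?A *\<^sub>v x) $ r"
  \<comment> \<open>The inverse of the ordering turns the vector into a grid function.\<close>
  define \<phi> where "\<phi> i j = x $ inv_into {..<?N} p (i, j)" for i j
  have \<phi>: "\<phi> (fst (p r)) (snd (p r)) = x $ r" if "r < ?N" for r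
    using that bij_betw_inv_into_left[OF bij] by (simp add: \<phi>_def)
  then have "x = vec ?N (\<lambda>s. \<phi> (fst (p s)) (snd (p s)))" using x by auto
  then have Ax: "?A *\<^sub>v x = vec ?N (\<lambda>r. scheme_op n \<mu> dt u v \<phi> (fst (p r)) (snd (p r)))"
    using scheme_matrix_mult_vec[OF assms(1,4)] by metis
  have op_nonneg: "0 \<le> scheme_op n \<mu> dt u v \<phi> i j" if ij: "(i, j) \<in> grid_points n" for i j
  proof -
    from ij obtain r where "r < ?N" "p r = (i, j)"
      unfolding bij_betw_imp_surj_on[OF bij, symmetric] by (auto simp del: add_2_eq_Suc')
    then show ?thesis using nonneg[of r] Ax by simp
  qed
  have \<phi>_nonneg: "0 \<le> \<phi> i j" if "(i, j) \<in> grid_points n" for i j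
    by (rule scheme_op_monotone[OF assms(1-3,5), folded h_def, OF assms(7-9) op_nonneg that])
  show "\<forall>r<?N. 0 \<le> x $ r"
  proof (intro allI impI)
    fix r assume r: "r < ?N"
    then have "(fst (p r), snd (p r)) \<in> grid_points n" using bij_betwE[OF bij] by simp
    from \<phi>_nonneg[OF this] show "0 \<le> x $ r" by (simp only: \<phi>[OF r])
  qed
qed

section \<open>The explicit conditions on mesh size and time step\<close>

text \<open>The hypothesis bounds \<open>a\<close> by the larger root of the quadratic, whose
  discriminant is \<open>4 * ((c + 3/2)\<^sup>2 + 48)\<close>.\<close>

lemma sqrt_minus_le_imp_quadratic:
  fixes a c :: real
  assumes "0 < c" "0 \<le> a" "2 * a \<le> (sqrt ((c + 3/2)\<^sup>2 + 48) - (c + 11/2)) / 4"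
  shows "8 * a\<^sup>2 + (11 + 2 * c) * a + c - 5/2 \<le> 0"
proof -
  have "8 * a + (c + 11/2) \<le> sqrt ((c + 3/2)\<^sup>2 + 48)" using assms by simp
  then have "(8 * a + (c + 11/2))\<^sup>2 \<le> (sqrt ((c + 3/2)\<^sup>2 + 48))\<^sup>2"
    using assms by (intro power_mono) auto
  also have "\<dots> = (c + 3/2)\<^sup>2 + 48" by simp
  finally show ?thesis by (simp add: power2_eq_square algebra_simps)
qed

theorem theorem3p9:
  fixes n :: nat and h \<mu> dt U :: real and u v :: "nat \<Rightarrow> nat \<Rightarrow> real"
    and p :: "nat \<Rightarrow> nat \<times> nat"
  assumes "odd n" and "h = mesh_size n" and "\<mu> > 0" and "dt > 0"
    and "grid_ordering n p"
    and "U = velocity_max_norm n u v"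
  shows
    "(\<forall>a. h * (U / (2 * \<mu>)) = a \<and> a < (sqrt 201 - 11) / 16 \<and>
          dt * (\<mu> / h\<^sup>2) \<ge> (2 * a + 1) / (- 8 * a\<^sup>2 - 11 * a + 5 / 2)
        \<longrightarrow> inverse_positive (scheme_matrix n \<mu> dt u v p)) \<and>
     (\<forall>c. dt * (\<mu> / h\<^sup>2) = 1 / c \<and> 1 / c > 2 / 5 \<and>
          h * (U / \<mu>) \<le> (sqrt ((c + 3 / 2)\<^sup>2 + 48) - (c + 11 / 2)) / 8
        \<longrightarrow> inverse_positive (scheme_matrix n \<mu> dt u v p)) \<and>
     (h * (U / \<mu>) \<le> 1 / 3 \<and> dt * (\<mu> / h\<^sup>2) \<ge> 3
        \<longrightarrow> inverse_positive (scheme_matrix n \<mu> dt u v p)) \<and>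
     (dt * (\<mu> / h\<^sup>2) \<ge> 1 \<and> h * (U / \<mu>) \<le> (sqrt 217 - 13) / 8
        \<longrightarrow> inverse_positive (scheme_matrix n \<mu> dt u v p))"
proof -
  define a where "a = h * (U / (2 * \<mu>))"
  define lam where "lam = dt * (\<mu> / h\<^sup>2)"
  have "h > 0" using assms by (simp add: mesh_size_def)
  have U: "\<bar>u i j\<bar> \<le> U" "\<bar>v i j\<bar> \<le> U" if "(i, j) \<in> interior_points n" for i j
  proof -
    have "finite (interior_points n)" by (simp add: interior_points_def grid_points_def)
    then have "max \<bar>u i j\<bar> \<bar>v i j\<bar> \<le> U"
      unfolding \<open>U = _\<close> velocity_max_norm_def using that by (intro Max_ge) force+
    then show "\<bar>u i j\<bar> \<le> U" "\<bar>v i j\<bar> \<le> U" by auto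
  qed
  \<comment> \<open>An interior point exists, so \<open>U\<close> dominates an absolute value and is
    nonnegative.\<close>
  have "(1, 1) \<in> interior_points n" using odd_pos[OF \<open>odd n\<close>] by (simp add: interior_points_iff)
  from U(1)[OF this] have "0 \<le> U" by linarith
  then have a: "0 \<le> a" using \<open>h > 0\<close> \<open>\<mu> > 0\<close> by (simp add: a_def)
  have bound: "\<bar>h * w / (2 * \<mu>)\<bar> \<le> a" if "\<bar>w\<bar> \<le> U" for w
    using that \<open>h > 0\<close> \<open>\<mu> > 0\<close> by (simp add: a_def abs_mult divide_right_mono)
  have main: "inverse_positive (scheme_matrix n \<mu> dt u v p)"
    if "1 + 2 * a \<le> lam * (5/2 - 11 * a - 8 * a\<^sup>2)"
    using that assms a bound U
    by (intro scheme_matrix_inverse_positive[where a = a]) (auto simp: lam_def)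
  have two_a: "h * (U / \<mu>) = 2 * a" by (simp add: a_def)
  have lam: "0 < lam" using \<open>h > 0\<close> assms by (simp add: lam_def)
  have "inverse_positive (scheme_matrix n \<mu> dt u v p)"
    if "a < (sqrt 201 - 11) / 16" "(2 * a + 1) / (- 8 * a\<^sup>2 - 11 * a + 5/2) \<le> lam"
  proof (rule main)
    \<comment> \<open>\<open>(sqrt 201 - 11) / 16\<close> is the positive root of
      \<open>8 * a\<^sup>2 + 11 * a - 5/2\<close>, so the denominator is positive.\<close>
    have "(16 * a + 11)\<^sup>2 < (sqrt 201)\<^sup>2"
      using that a by (intro power_strict_mono) auto
    then have "0 < - 8 * a\<^sup>2 - 11 * a + 5/2" by (simp add: power2_eq_square algebra_simps)
    then show "1 + 2 * a \<le> lam * (5/2 - 11 * a - 8 * a\<^sup>2)"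
      using that by (simp add: pos_divide_le_eq algebra_simps)
  qed
  moreover have "inverse_positive (scheme_matrix n \<mu> dt u v p)"
    if c: "lam = 1 / c" "2 * a \<le> (sqrt ((c + 3 / 2)\<^sup>2 + 48) - (c + 11 / 2)) / 8" for c
  proof (rule main)
    have "0 < c" using lam c by simp
    \<comment> \<open>Since \<open>2 * a\<close> is nonnegative, so is its upper bound, and dividing
      by 4 instead of 8 enlarges that bound.\<close>
    moreover have "2 * a \<le> (sqrt ((c + 3/2)\<^sup>2 + 48) - (c + 11/2)) / 4" using c a by linarith
    ultimately have "8 * a\<^sup>2 + (11 + 2 * c) * a + c - 5/2 \<le> 0"
      using a by (intro sqrt_minus_le_imp_quadratic)
    then have "(1 + 2 * a) * c \<le> 5/2 - 11 * a - 8 * a\<^sup>2" by (simp add: algebra_simps)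
    then show "1 + 2 * a \<le> lam * (5/2 - 11 * a - 8 * a\<^sup>2)"
      unfolding c(1) using \<open>0 < c\<close> by (simp add: pos_le_divide_eq)
  qed
  moreover have "inverse_positive (scheme_matrix n \<mu> dt u v p)"
    if "2 * a \<le> 1 / 3" "3 \<le> lam"
  proof (rule main)
    \<comment> \<open>At \<open>a = 1/6\<close> the polynomial equals 4/9 and
      \<open>1 + 2 * a\<close> equals 4/3, so \<open>lam = 3\<close> gives equality.\<close>
    have "a\<^sup>2 \<le> (1/6)\<^sup>2" using that a by (intro power_mono) auto
    then have *: "4/9 \<le> 5/2 - 11 * a - 8 * a\<^sup>2" using that by (simp add: power2_eq_square)
    have "1 + 2 * a \<le> 3 * (4/9)" using that by simp
    also have "\<dots> \<le> lam * (5/2 - 11 * a - 8 * a\<^sup>2)" using * that by (intro mult_mono) auto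
    finally show "1 + 2 * a \<le> lam * (5/2 - 11 * a - 8 * a\<^sup>2)" .
  qed
  moreover have "inverse_positive (scheme_matrix n \<mu> dt u v p)"
    if "1 \<le> lam" "2 * a \<le> (sqrt 217 - 13) / 8"
  proof (rule main)
    \<comment> \<open>\<open>(sqrt 217 - 13) / 16\<close> is the positive root for
      \<open>lam = 1\<close>; a larger \<open>lam\<close> only helps, the polynomial being
      positive.\<close>
    have "(16 * a + 13)\<^sup>2 \<le> (sqrt 217)\<^sup>2" using that a by (intro power_mono) auto
    then have *: "1 + 2 * a \<le> 5/2 - 11 * a - 8 * a\<^sup>2" by (simp add: power2_eq_square algebra_simps)
    also have "\<dots> \<le> lam * (5/2 - 11 * a - 8 * a\<^sup>2)"
      using * a that mult_right_mono[of 1 lam "5/2 - 11 * a - 8 * a\<^sup>2"] by simp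
    finally show "1 + 2 * a \<le> lam * (5/2 - 11 * a - 8 * a\<^sup>2)" .
  qed
  ultimately show ?thesis unfolding two_a a_def[symmetric] lam_def[symmetric] by blast
qed

end
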